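(* Let $G$ be a bipanpositionable graph with at least $4$ vertices. Then $f_p(G,v)=4$ for every vertex $v\in V(G)$.
   Context: All graphs are finite, simple and connected; $\textrm{dist}_G(x,y)$ denotes the length of a shortest $xy$ path in $G$, and for a cycle $C$ in $G$ through $x,y$, $\textrm{dist}_C(x,y)$ is the distance between $x$ and $y$ along $C$. A hamiltonian bipartite graph $G$ is \emph{bipanpositionable} if for any two distinct vertices $x,y\in V(G)$ and any integer $k$ with $\textrm{dist}_G(x,y)\le k\le |V(G)|/2$ and $k-\textrm{dist}_G(x,y)$ even, there is a hamiltonian cycle $C$ of $G$ with $\textrm{dist}_C(x,y)=k$. The \emph{path variant of the Explorer–Director game} on $G$ with starting vertex $v$: a single token starts on $v$. In each round, if the token is on vertex $u$, the Explorer names a positive integer $l$ such that $G$ contains a path (no repeated vertices) of length $l$ starting at $u$, and the Director moves the token to any vertex $w$ such that $G$ contains a $uw$ path of length $l$. A vertex is visited if the token has ever been on it (the starting vertex counts as visited). The Explorer aims to maximize and the Director to minimize the number of visited vertices; the game ends when the Director can keep the token on already visited vertices indefinitely. $f_p(G,v)$ denotes the number of visited vertices at the end under optimal play by both players. *)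

theory Defs
  imports "Graph_Theory.Graph_Theory"
begin

text \<open>A finite simple graph is a \<^locale>\<open>pair_graph\<close>: an undirected edge is represented by
  its two opposite arcs, and there are no loops.\<close>

section \<open>Paths, distance and hamiltonian cycles\<close>

definition has_path :: "'a pair_pre_digraph \<Rightarrow> 'a \<Rightarrow> nat \<Rightarrow> 'a \<Rightarrow> bool" where
  "has_path G u l w \<longleftrightarrow>
     (\<exists>p. vpath p (with_proj G) \<and> hd p = u \<and> last p = w \<and> vwalk_length p = l)"

definition gdist :: "'a pair_pre_digraph \<Rightarrow> 'a \<Rightarrow> 'a \<Rightarrow> nat" where
  "gdist G x y = (LEAST l. has_path G x l y)"

text \<open>A hamiltonian cycle is given by the list of its vertices in cyclic order, each
  vertex of the graph being listed exactly once.\<close>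

definition hamiltonian_cycle :: "'a pair_pre_digraph \<Rightarrow> 'a list \<Rightarrow> bool" where
  "hamiltonian_cycle G C \<longleftrightarrow>
     3 \<le> length C \<and> distinct C \<and> set C = pverts G \<and>
     (\<forall>i<length C. (C ! i, C ! (Suc i mod length C)) \<in> parcs G)"

definition hamiltonian :: "'a pair_pre_digraph \<Rightarrow> bool" where
  "hamiltonian G \<longleftrightarrow> (\<exists>C. hamiltonian_cycle G C)"

text \<open>The least number of steps along the cycle that lead from one of the two vertices to
  the other. Since either of them may be the starting point, both directions around the
  cycle are taken into account.\<close>

definition cycle_dist :: "'a list \<Rightarrow> 'a \<Rightarrow> 'a \<Rightarrow> nat" where
  "cycle_dist C x y =
     (LEAST k. \<exists>i<length C. {C ! i, C ! ((i + k) mod length C)} = {x, y})"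

definition bipartite :: "'a pair_pre_digraph \<Rightarrow> bool" where
  "bipartite G \<longleftrightarrow>
     (\<exists>A B. A \<union> B = pverts G \<and> A \<inter> B = {} \<and> parcs G \<subseteq> A \<times> B \<union> B \<times> A)"

definition bipanpositionable :: "'a pair_pre_digraph \<Rightarrow> bool" where
  "bipanpositionable G \<longleftrightarrow>
     hamiltonian G \<and> bipartite G \<and>
     (\<forall>x\<in>pverts G. \<forall>y\<in>pverts G. \<forall>k. x \<noteq> y \<longrightarrow>
        gdist G x y \<le> k \<longrightarrow> 2 * k \<le> card (pverts G) \<longrightarrow> even (k - gdist G x y) \<longrightarrow>
        (\<exists>C. hamiltonian_cycle G C \<and> cycle_dist C x y = k))"

section \<open>The path variant of the Explorer-Director game\<close>

definition can_name :: "'a pair_pre_digraph \<Rightarrow> 'a \<Rightarrow> nat \<Rightarrow> bool" where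
  "can_name G u l \<longleftrightarrow> 0 < l \<and> (\<exists>w. has_path G u l w)"

text \<open>A history lists the rounds played so far in chronological order; a round consists of
  the length named by the Explorer and the vertex chosen by the Director.\<close>

type_synonym 'a history = "(nat \<times> 'a) list"

definition token :: "'a \<Rightarrow> 'a history \<Rightarrow> 'a" where
  "token v h = last (v # map snd h)"

definition visited :: "'a \<Rightarrow> 'a history \<Rightarrow> 'a set" where
  "visited v h = insert v (snd ` set h)"

type_synonym 'a explorer_strategy = "'a history \<Rightarrow> nat"
type_synonym 'a director_strategy = "'a history \<Rightarrow> nat \<Rightarrow> 'a"

definition legal_explorer ::
    "'a pair_pre_digraph \<Rightarrow> 'a \<Rightarrow> 'a explorer_strategy \<Rightarrow> bool" where
  "legal_explorer G v \<sigma> \<longleftrightarrow>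
     (\<forall>h. (\<exists>l. can_name G (token v h) l) \<longrightarrow> can_name G (token v h) (\<sigma> h))"

definition legal_director ::
    "'a pair_pre_digraph \<Rightarrow> 'a \<Rightarrow> 'a director_strategy \<Rightarrow> bool" where
  "legal_director G v \<tau> \<longleftrightarrow>
     (\<forall>h l. can_name G (token v h) l \<longrightarrow> has_path G (token v h) l (\<tau> h l))"

primrec play :: "'a explorer_strategy \<Rightarrow> 'a director_strategy \<Rightarrow> nat \<Rightarrow> 'a history" where
  "play \<sigma> \<tau> 0 = []"
| "play \<sigma> \<tau> (Suc n) =
     (let h = play \<sigma> \<tau> n; l = \<sigma> h in h @ [(l, \<tau> h l)])"

text \<open>The Director can keep a token that is on \<open>u\<close> within \<open>U\<close> indefinitely. If no length
  can be named at \<open>u\<close> (one-vertex graph), this holds vacuously and the game is over.\<close>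

coinductive can_stay :: "'a pair_pre_digraph \<Rightarrow> 'a set \<Rightarrow> 'a \<Rightarrow> bool" for G U where
  "u \<in> U \<Longrightarrow> (\<And>l. can_name G u l \<Longrightarrow> \<exists>w. has_path G u l w \<and> can_stay G U w) \<Longrightarrow>
   can_stay G U u"

definition game_over :: "'a pair_pre_digraph \<Rightarrow> 'a \<Rightarrow> 'a history \<Rightarrow> bool" where
  "game_over G v h \<longleftrightarrow> can_stay G (visited v h) (token v h)"

text \<open>The number of vertices visited when the game ends. A play may fail to end, if the
  Explorer never uses the possibility of forcing a new vertex; then all vertices that are
  ever visited are counted.\<close>

definition payoff ::
    "'a pair_pre_digraph \<Rightarrow> 'a \<Rightarrow> 'a explorer_strategy \<Rightarrow> 'a director_strategy \<Rightarrow> nat" where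
  "payoff G v \<sigma> \<tau> =
     (if \<exists>n. game_over G v (play \<sigma> \<tau> n)
      then card (visited v (play \<sigma> \<tau> (LEAST n. game_over G v (play \<sigma> \<tau> n))))
      else card (\<Union>n. visited v (play \<sigma> \<tau> n)))"

text \<open>Optimal play by both players: the Explorer can guarantee at least \<open>m\<close> visited
  vertices and the Director can guarantee at most \<open>m\<close>.\<close>

definition game_value :: "'a pair_pre_digraph \<Rightarrow> 'a \<Rightarrow> nat \<Rightarrow> bool" where
  "game_value G v m \<longleftrightarrow>
     (\<exists>\<sigma>. legal_explorer G v \<sigma> \<and> (\<forall>\<tau>. legal_director G v \<tau> \<longrightarrow> m \<le> payoff G v \<sigma> \<tau>)) \<and>
     (\<exists>\<tau>. legal_director G v \<tau> \<and> (\<forall>\<sigma>. legal_explorer G v \<sigma> \<longrightarrow> payoff G v \<sigma> \<tau> \<le> m))"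

lemma game_value_unique: "game_value G v m \<Longrightarrow> game_value G v m' \<Longrightarrow> m = m'"
  unfolding game_value_def by (meson le_antisym le_trans)

definition f_p :: "'a pair_pre_digraph \<Rightarrow> 'a \<Rightarrow> nat" where
  "f_p G v = (THE m. game_value G v m)"

end

theory Submission
  imports Defs
begin

text \<open>In a bipartite graph a path of odd length ends in the other part and a path of positive
  even length ends at another vertex of the same part. Hence the Explorer forces three new
  vertices by naming 2, 1, 2. Conversely, let \<open>n\<close> be the number of vertices.
  Bipanpositionability yields paths of every odd length below \<open>n\<close> between adjacent vertices, and
  of every positive even length below \<open>n\<close> between vertices at distance 2: going around the
  hamiltonian cycle the other way turns length \<open>k\<close> into \<open>n - k\<close>. Each of the four vertices of a
  path of length 3 is adjacent to another one and at distance 2 from a third, so the Director can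
  keep the token among them.\<close>

section \<open>Paths\<close>

text \<open>Replaces the recursively built arc list by consecutive positions, as index-based
  reasoning about paths requires.\<close>

lemma set_vwalk_arcs_conv:
  "set (vwalk_arcs p) = {(p ! i, p ! Suc i) | i. Suc i < length p}"
proof (induction p rule: vwalk_arcs.induct)
  case (3 x y xs)
  have "{((x # y # xs) ! i, (x # y # xs) ! Suc i) | i. Suc i < length (x # y # xs)} =
    insert (x, y) {((y # xs) ! i, (y # xs) ! Suc i) | i. Suc i < length (y # xs)}" (is "?L = insert _ ?R")
  proof (intro set_eqI iffI)
    fix e assume "e \<in> ?L"
    then obtain i where "e = ((x # y # xs) ! i, (x # y # xs) ! Suc i)" "Suc i < length (x # y # xs)"
      by blast
    then show "e \<in> insert (x, y) ?R" by (cases i) auto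
  next
    fix e assume "e \<in> insert (x, y) ?R"
    then consider "e = (x, y)" | i where "e = ((y # xs) ! i, (y # xs) ! Suc i)" "Suc i < length (y # xs)"
      by blast
    then show "e \<in> ?L"
    proof cases
      case 1 then show ?thesis by force
    next
      case (2 i) then show ?thesis by (auto intro!: exI[of _ "Suc i"])
    qed
  qed
  with 3 show ?case by simp
qed auto

text \<open>With a path seen as an injective map \<open>f\<close> on positions, reversing it,
  cutting it and walking around a cycle become index arithmetic. The image condition is what keeps
  the case \<open>l = 0\<close> inside the graph: there no arc says anything about
  \<open>u\<close>.\<close>

lemma has_path_iff:
  "has_path G u l w \<longleftrightarrow>
     (\<exists>f. f 0 = u \<and> f l = w \<and> inj_on f {..l} \<and> f ` {..l} \<subseteq> pverts G \<and>
          (\<forall>i<l. (f i, f (Suc i)) \<in> parcs G))" (is "?L \<longleftrightarrow> ?R")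
proof
  assume ?L
  then obtain p where p: "vwalk p (with_proj G)" "distinct p" "hd p = u" "last p = w"
      "length p - 1 = l"
    unfolding has_path_def vpath_def by auto
  then have ne: "p \<noteq> []" and len: "length p = Suc l" by (auto simp: vwalk_def Suc_leI)
  have "p ! 0 = u" "p ! l = w" using p ne by (simp_all add: hd_conv_nth last_conv_nth)
  moreover have "inj_on (\<lambda>i. p ! i) {..l}"
    using p(2) len by (auto simp: inj_on_def nth_eq_iff_index_eq)
  moreover have "(\<lambda>i. p ! i) ` {..l} \<subseteq> pverts G"
    using p(1) len unfolding vwalk_def by (auto simp: subset_iff)
  moreover have "\<forall>i<l. (p ! i, p ! Suc i) \<in> parcs G"
    using p(1) len unfolding vwalk_def set_vwalk_arcs_conv by auto
  ultimately show ?R by blast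
next
  assume ?R
  then obtain f where f: "f 0 = u" "f l = w" "inj_on f {..l}" "f ` {..l} \<subseteq> pverts G"
      "\<forall>i<l. (f i, f (Suc i)) \<in> parcs G" by blast
  define p where "p = map f [0..<Suc l]"
  have len: "length p = Suc l" and nth: "\<And>i. i \<le> l \<Longrightarrow> p ! i = f i"
    unfolding p_def by (simp, metis diff_add_inverse2 less_Suc_eq_le minus_nat.diff_0 nth_map_upt add_0)
  have upt: "set [0..<Suc l] = {..l}" by auto
  then have setp: "set p = f ` {..l}" unfolding p_def set_map by simp
  have "distinct p"
    unfolding p_def distinct_map upt using f(3) by simp
  moreover have "vwalk p (with_proj G)"
    unfolding vwalk_def set_vwalk_arcs_conv using setp f(4,5) len nth by auto
  moreover have "p \<noteq> []" using len by auto
  then have "hd p = u" "last p = w" using f len nth by (simp_all add: hd_conv_nth last_conv_nth)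
  ultimately show ?L unfolding has_path_def vpath_def using len by auto
qed

lemma has_path_sym:
  assumes "pair_graph G" "has_path G u l w"
  shows "has_path G w l u"
proof -
  interpret pair_graph G by fact
  have sym: "(y, x) \<in> parcs G" if "(x, y) \<in> parcs G" for x y
    using pair_sym_arcs that by (auto simp: symmetric_def sym_def)
  from assms(2) obtain f where f: "f 0 = u" "f l = w" "inj_on f {..l}" "f ` {..l} \<subseteq> pverts G"
      "\<forall>i<l. (f i, f (Suc i)) \<in> parcs G" unfolding has_path_iff by blast
  have "inj_on (\<lambda>i. f (l - i)) {..l}"
  proof (rule inj_onI)
    fix s t assume "s \<in> {..l}" "t \<in> {..l}" "f (l - s) = f (l - t)"
    then show "s = t" using inj_onD[OF f(3), of "l - s" "l - t"] by auto
  qed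
  moreover have "(f (l - i), f (l - Suc i)) \<in> parcs G" if "i < l" for i
    using f(5)[rule_format, of "l - Suc i"] that by (auto simp: Suc_diff_Suc intro: sym)
  ultimately show ?thesis
    unfolding has_path_iff using f by (intro exI[of _ "\<lambda>i. f (l - i)"]) auto
qed

lemma has_path_verts: "has_path G u l w \<Longrightarrow> u \<in> pverts G \<and> w \<in> pverts G"
  unfolding has_path_iff by (auto simp: image_subset_iff)

lemma has_path_length:
  assumes "has_path G u l w" "finite (pverts G)"
  shows "l < card (pverts G)"
proof -
  from assms(1) obtain f :: "nat \<Rightarrow> 'a" where "inj_on f {..l}" "f ` {..l} \<subseteq> pverts G"
    unfolding has_path_iff by blast
  then show ?thesis using card_inj_on_le[of f "{..l}" "pverts G"] assms(2) by auto
qed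

lemma has_path_neq: "has_path G u l w \<Longrightarrow> 0 < l \<Longrightarrow> u \<noteq> w"
  unfolding has_path_iff by (auto dest: inj_onD[where x = 0])

text \<open>Take membership in one part as the colour; every arc flips it, so after \<open>i\<close>
  steps it has been flipped \<open>i\<close> times.\<close>

lemma bipartite_coloring:
  assumes "bipartite G"
  obtains c :: "'a \<Rightarrow> bool" where "\<And>u l w. has_path G u l w \<Longrightarrow> c u = c w \<longleftrightarrow> even l"
proof -
  from assms obtain A B where AB: "A \<inter> B = {}" "parcs G \<subseteq> A \<times> B \<union> B \<times> A"
    unfolding bipartite_def by blast
  have arc: "x \<in> A \<longleftrightarrow> y \<notin> A" if "(x, y) \<in> parcs G" for x y using AB that by auto
  have "(u \<in> A) = (w \<in> A) \<longleftrightarrow> even l" if path: "has_path G u l w" for u l w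
  proof -
    from path obtain f where f: "f 0 = u" "f l = w" "\<forall>i<l. (f i, f (Suc i)) \<in> parcs G"
      unfolding has_path_iff by blast
    have "i \<le> l \<Longrightarrow> (f 0 \<in> A) = (f i \<in> A) \<longleftrightarrow> even i" for i
    proof (induction i)
      case (Suc i)
      then show ?case using f(3) arc[of "f i" "f (Suc i)"] by auto
    qed simp
    from this[of l] f show ?thesis by simp
  qed
  then show thesis by (rule that)
qed

section \<open>Hamiltonian cycles\<close>

text \<open>Walk \<open>l\<close> steps forward around the cycle. Since \<open>l\<close> is below
  the number of vertices, the walk stops before it returns to its start, so no vertex
  repeats.\<close>

lemma hamiltonian_cycle_path:
  assumes C: "hamiltonian_cycle G C" and il: "i < length C" "l < length C"
  shows "has_path G (C ! i) l (C ! ((i + l) mod length C))"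
proof -
  let ?n = "length C" and ?f = "\<lambda>t. C ! ((i + t) mod length C)"
  have d: "distinct C" and s: "set C = pverts G"
    and a: "\<And>j. j < ?n \<Longrightarrow> (C ! j, C ! (Suc j mod ?n)) \<in> parcs G"
    using C unfolding hamiltonian_cycle_def by auto
  have pos: "0 < ?n" using il by linarith
  \<comment> \<open>Equal residues make \<open>?n\<close> divide \<open>t - s\<close>, which is
    smaller than \<open>?n\<close>; the order \<open>s \<le> t\<close> keeps this subtraction from
    being truncated.\<close>
  have shift: "s = t" if "(i + s) mod ?n = (i + t) mod ?n" "s \<le> t" "t < ?n" for s t
  proof -
    have "?n dvd (i + t) - (i + s)" using that mod_eq_dvd_iff_nat[of "i + s" "i + t" ?n] by simp
    with that show ?thesis by (auto dest: dvd_imp_le)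
  qed
  have "inj_on ?f {..l}"
  proof (rule inj_onI)
    fix s t assume st: "s \<in> {..l}" "t \<in> {..l}" "?f s = ?f t"
    then have "(i + s) mod ?n = (i + t) mod ?n"
      using d pos by (simp add: nth_eq_iff_index_eq)
    with st il show "s = t" using shift[of s t] shift[of t s] by (cases "s \<le> t") auto
  qed
  moreover have "?f ` {..l} \<subseteq> pverts G"
    using pos unfolding s[symmetric] image_subset_iff by (metis mod_less_divisor nth_mem)
  moreover have "(?f t, ?f (Suc t)) \<in> parcs G" for t
    using a[of "(i + t) mod ?n"] pos by (simp add: mod_Suc_eq)
  ultimately show ?thesis
    unfolding has_path_iff using il by (intro exI[of _ ?f]) auto
qed

text \<open>Read the hamiltonian cycle from \<open>u\<close> on; this is the source of the lengths
  that the Explorer can name.\<close>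

lemma hamiltonian_path_from:
  assumes "hamiltonian G" "u \<in> pverts G" "l < card (pverts G)"
  obtains w where "has_path G u l w"
proof -
  from assms obtain C where C: "hamiltonian_cycle G C" unfolding hamiltonian_def by blast
  then have "length C = card (pverts G)" "u \<in> set C"
    using assms unfolding hamiltonian_cycle_def by (auto simp flip: distinct_card)
  with hamiltonian_cycle_path[OF C] assms that show thesis by (metis in_set_conv_nth)
qed

text \<open>Going around the cycle without its closing arc takes \<open>n - 1\<close> steps, and the
  closing arc joins opposite colours; hence \<open>n - 1\<close> is odd.\<close>

lemma even_card_hamiltonian_bipartite:
  assumes "hamiltonian G" "bipartite G"
  shows "even (card (pverts G))"
proof -
  from assms obtain C where C: "hamiltonian_cycle G C" unfolding hamiltonian_def by blast
  let ?n = "length C"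
  have n: "3 \<le> ?n" "?n = card (pverts G)"
    using C unfolding hamiltonian_cycle_def by (auto simp flip: distinct_card)
  obtain c :: "'a \<Rightarrow> bool" where c: "\<And>u l w. has_path G u l w \<Longrightarrow> c u = c w \<longleftrightarrow> even l"
    using bipartite_coloring[OF assms(2)] by blast
  have "has_path G (C ! 0) (?n - 1) (C ! (?n - 1))"
    using hamiltonian_cycle_path[OF C, of 0 "?n - 1"] n by simp
  moreover have "Suc (?n - 1) mod ?n = 0" using n by simp
  then have "has_path G (C ! (?n - 1)) 1 (C ! 0)"
    using hamiltonian_cycle_path[OF C, of "?n - 1" 1] n by simp
  ultimately have "c (C ! 0) = c (C ! (?n - 1)) \<longleftrightarrow> even (?n - 1)"
    "c (C ! (?n - 1)) = c (C ! 0) \<longleftrightarrow> even (1::nat)" using c by blast+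
  then have "odd (?n - 1)" by auto
  then show ?thesis using n by auto
qed

text \<open>The two vertices cut the cycle into two complementary arcs, and reversal orients each of
  them from \<open>x\<close> to \<open>y\<close>.\<close>

lemma cycle_dist_paths:
  assumes "pair_graph G" and C: "hamiltonian_cycle G C"
    and xy: "x \<in> pverts G" "y \<in> pverts G"
    and k: "cycle_dist C x y = k" "0 < k" "k < card (pverts G)"
  shows "has_path G x k y" "has_path G x (card (pverts G) - k) y"
proof -
  let ?n = "length C"
  have n: "?n = card (pverts G)" and s: "set C = pverts G"
    using C unfolding hamiltonian_cycle_def by (auto simp flip: distinct_card)
  obtain i j where ij: "i < ?n" "x = C ! i" "j < ?n" "y = C ! j"
    using xy s by (metis in_set_conv_nth)
  \<comment> \<open>Some number of steps leads from \<open>x\<close> to \<open>y\<close>, so the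
    \<open>LEAST\<close> in \<open>cycle_dist\<close> is attained; adding \<open>?n\<close> avoids
    truncated subtraction when \<open>j < i\<close>.\<close>
  then have "{C ! i, C ! ((i + (?n + j - i)) mod ?n)} = {x, y}" by simp
  then have "\<exists>k. \<exists>i<length C. {C ! i, C ! ((i + k) mod length C)} = {x, y}" using ij by blast
  then have "\<exists>i<length C. {C ! i, C ! ((i + k) mod length C)} = {x, y}"
    unfolding k(1)[symmetric] cycle_dist_def by (rule LeastI_ex)
  then obtain i where i: "i < ?n" "{C ! i, C ! ((i + k) mod ?n)} = {x, y}" by blast
  let ?j = "(i + k) mod ?n"
  have "(?j + (?n - k)) mod ?n = (i + k + (?n - k)) mod ?n" by (rule mod_add_left_eq)
  also have "i + k + (?n - k) = i + ?n" using k n by simp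
  also have "(i + ?n) mod ?n = i" using i by simp
  finally have "(?j + (?n - k)) mod ?n = i" .
  moreover have "?j < ?n" using i by (intro mod_less_divisor) linarith
  ultimately have 1: "has_path G (C ! i) k (C ! ?j)" and 2: "has_path G (C ! ?j) (?n - k) (C ! i)"
    using hamiltonian_cycle_path[OF C, of i k] hamiltonian_cycle_path[OF C, of ?j "?n - k"] i k n
    by auto
  \<comment> \<open>The unordered pair leaves open at which of the two vertices the count
    starts.\<close>
  from i(2) have "C ! i = x \<and> C ! ?j = y \<or> C ! i = y \<and> C ! ?j = x" by (auto simp: doubleton_eq_iff)
  then show "has_path G x k y" "has_path G x (card (pverts G) - k) y"
    using 1 2 has_path_sym[OF assms(1)] n by auto
qed

section \<open>Path lengths between vertices of a bipanpositionable graph\<close>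

text \<open>The definition only reaches lengths up to \<open>n / 2\<close>; a larger
  \<open>l\<close> is the complementary arc of \<open>n - l\<close>, which has the right parity
  because \<open>n\<close> is even. The path assumed in \<open>d\<close> ensures that the
  \<open>LEAST\<close> in \<open>gdist\<close> is attained.\<close>

lemma bipanpositionable_path:
  assumes G: "pair_graph G" "bipanpositionable G"
    and d: "has_path G x (gdist G x y) y" "x \<noteq> y"
    and l: "gdist G x y \<le> l" "l + gdist G x y \<le> card (pverts G)" "even (l - gdist G x y)"
  shows "has_path G x l y"
proof -
  let ?n = "card (pverts G)"
  have xy: "x \<in> pverts G" "y \<in> pverts G" using has_path_verts[OF d(1)] by auto
  have "even ?n"
    using G(2) even_card_hamiltonian_bipartite unfolding bipanpositionable_def by blast
  \<comment> \<open>A positive distance makes the complementary arc shorter than a full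
    turn.\<close>
  have pos: "0 < gdist G x y" using d by (metis has_path_iff gr0I)
  have *: "has_path G x k y \<and> has_path G x (?n - k) y"
    if k: "gdist G x y \<le> k" "2 * k \<le> ?n" "even (k - gdist G x y)" for k
  proof -
    obtain C where "hamiltonian_cycle G C" "cycle_dist C x y = k"
      using G(2) xy d(2) k unfolding bipanpositionable_def by blast
    then show ?thesis using cycle_dist_paths[OF G(1)] xy k pos by auto
  qed
  show ?thesis
  proof (cases "2 * l \<le> ?n")
    case True then show ?thesis using * l by blast
  next
    case False
    have "even (?n - l - gdist G x y)" using \<open>even ?n\<close> l by simp
    then show ?thesis using *[of "?n - l"] False l by auto
  qed
qed

lemma gdist_eqI:
  assumes "has_path G x d y" "\<And>l. l < d \<Longrightarrow> \<not> has_path G x l y"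
  shows "gdist G x y = d"
  unfolding gdist_def
proof (rule Least_equality)
  show "d \<le> l" if "has_path G x l y" for l
    using assms(2)[of l] that by linarith
qed (rule assms(1))

lemma odd_path:
  assumes "pair_graph G" "bipanpositionable G" "has_path G x 1 y" "odd l" "l < card (pverts G)"
  shows "has_path G x l y"
proof -
  have ne: "x \<noteq> y" using has_path_neq[OF assms(3)] by simp
  then have "\<not> has_path G x 0 y" unfolding has_path_iff by auto
  then have "gdist G x y = 1" using assms(3) by (intro gdist_eqI) auto
  then show ?thesis using bipanpositionable_path[OF assms(1,2), of x y l] assms ne
    by (auto elim: oddE)
qed

text \<open>Equal colours rule out adjacency, so the distance is exactly 2.\<close>

lemma even_path:
  assumes "pair_graph G" "bipanpositionable G" "has_path G x 2 y" "even l" "0 < l"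
    "l < card (pverts G)"
  shows "has_path G x l y"
proof -
  have hb: "hamiltonian G" "bipartite G" using assms(2) unfolding bipanpositionable_def by auto
  have ne: "x \<noteq> y" using has_path_neq[OF assms(3)] by simp
  then have "\<not> has_path G x 0 y" unfolding has_path_iff by auto
  moreover obtain c :: "'a \<Rightarrow> bool" where c: "\<And>u l w. has_path G u l w \<Longrightarrow> c u = c w \<longleftrightarrow> even l"
    using bipartite_coloring[OF hb(2)] by blast
  then have "\<not> has_path G x 1 y" using c[of x 1 y] c[OF assms(3)] by auto
  ultimately have d: "gdist G x y = 2"
    using assms(3) by (intro gdist_eqI) (auto simp: less_2_cases_iff)
  \<comment> \<open>Both \<open>l\<close> and the number of vertices are even, so the strict
    inequality between them leaves a gap of at least 2.\<close>
  have "2 \<le> l" "l + 2 \<le> card (pverts G)"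
    using assms(4-6) even_card_hamiltonian_bipartite[OF hb] by presburger+
  then show ?thesis using bipanpositionable_path[OF assms(1,2), of x y l] assms ne d by auto
qed

section \<open>The game\<close>

lemma token_Nil [simp]: "token v [] = v"
  and token_snoc [simp]: "token v (h @ [(l, w)]) = w"
  by (simp_all add: token_def)

lemma visited_Nil [simp]: "visited v [] = {v}"
  and visited_snoc [simp]: "visited v (h @ [(l, w)]) = insert w (visited v h)"
  by (auto simp: visited_def)

lemma visited_play_mono: "m \<le> n \<Longrightarrow> visited v (play \<sigma> \<tau> m) \<subseteq> visited v (play \<sigma> \<tau> n)"
  by (induction n) (auto simp: Let_def le_Suc_eq)

text \<open>An invariant of the token, applied both to the Director's trap and to the whole vertex
  set.\<close>

lemma visited_subset:
  assumes "v \<in> P"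
    and step: "\<And>h. token v h \<in> P \<Longrightarrow> \<tau> h (\<sigma> h) \<in> P"
  shows "visited v (play \<sigma> \<tau> n) \<subseteq> P"
proof -
  have "token v (play \<sigma> \<tau> n) \<in> P \<and> visited v (play \<sigma> \<tau> n) \<subseteq> P"
    by (induction n) (use assms in \<open>auto simp: Let_def\<close>)
  then show ?thesis by simp
qed

section \<open>Guarantees for the two players\<close>

text \<open>The set \<open>P\<close> is a trap: every nameable length has an answer inside it. The
  assumption \<open>name\<close> enters because a legal Explorer is bound to nameable lengths only
  at vertices where one exists.\<close>

lemma director_upper_bound:
  assumes P: "finite P" "P \<subseteq> pverts G" "v \<in> P"
    and stay: "\<And>u l. u \<in> P \<Longrightarrow> can_name G u l \<Longrightarrow> \<exists>w\<in>P. has_path G u l w"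
    and name: "\<And>u. u \<in> P \<Longrightarrow> \<exists>l. can_name G u l"
  shows "\<exists>\<tau>. legal_director G v \<tau> \<and> (\<forall>\<sigma>. legal_explorer G v \<sigma> \<longrightarrow> payoff G v \<sigma> \<tau> \<le> card P)"
proof -
  \<comment> \<open>Off \<open>P\<close> any legal answer will do; for lengths that cannot be named,
    legality demands nothing.\<close>
  define \<tau> where "\<tau> h l = (SOME w. has_path G (token v h) l w \<and> (token v h \<in> P \<longrightarrow> w \<in> P))" for h l
  have \<tau>: "has_path G (token v h) l (\<tau> h l) \<and> (token v h \<in> P \<longrightarrow> \<tau> h l \<in> P)"
    if "can_name G (token v h) l" for h l
    unfolding \<tau>_def by (rule someI_ex) (use stay that in \<open>auto simp: can_name_def\<close>)
  have "payoff G v \<sigma> \<tau> \<le> card P" if \<sigma>: "legal_explorer G v \<sigma>" for \<sigma>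
  proof -
    have "\<tau> h (\<sigma> h) \<in> P" if "token v h \<in> P" for h
      using \<tau> \<sigma> name that unfolding legal_explorer_def by blast
    then have "visited v (play \<sigma> \<tau> n) \<subseteq> P" for n
      using visited_subset P(3) by metis
    then show ?thesis unfolding payoff_def using P(1) by (auto intro!: card_mono)
  qed
  then show ?thesis using \<tau> unfolding legal_director_def by blast
qed

text \<open>Each of the first three moves leaves the visited set whatever the Director answers. So
  the game cannot end earlier, and an unending play counts these four vertices too.\<close>

lemma explorer_lower_bound:
  assumes G: "finite (pverts G)" "bipartite G" and v: "v \<in> pverts G"
    and name: "\<And>u. u \<in> pverts G \<Longrightarrow> can_name G u 1 \<and> can_name G u 2"
  shows "\<exists>\<sigma>. legal_explorer G v \<sigma> \<and> (\<forall>\<tau>. legal_director G v \<tau> \<longrightarrow> 4 \<le> payoff G v \<sigma> \<tau>)"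
proof -
  obtain c :: "'a \<Rightarrow> bool" where c: "\<And>u l w. has_path G u l w \<Longrightarrow> c u = c w \<longleftrightarrow> even l"
    using bipartite_coloring[OF G(2)] by blast
  \<comment> \<open>The strategy looks only at the number of rounds; from the fourth round on, the 2
    merely keeps it legal.\<close>
  define \<sigma> :: "'a explorer_strategy" where
    "\<sigma> h = (if length h = 1 then 1 else 2)" for h
  have vert: "u \<in> pverts G" if "can_name G u l" for u l
    using that unfolding can_name_def by (blast dest: has_path_verts)
  have legal: "legal_explorer G v \<sigma>"
    unfolding legal_explorer_def \<sigma>_def using name vert by auto
  have "4 \<le> payoff G v \<sigma> \<tau>" if \<tau>: "legal_director G v \<tau>" for \<tau>
  proof -
    let ?h = "play \<sigma> \<tau>"
    have step: "has_path G (token v h) (\<sigma> h) (\<tau> h (\<sigma> h))" if "token v h \<in> pverts G" for h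
      using \<tau> name[OF that] unfolding legal_director_def \<sigma>_def by auto
    define w1 w2 w3 where w: "w1 = \<tau> [] 2" "w2 = \<tau> [(2, w1)] 1" "w3 = \<tau> [(2, w1), (1, w2)] 2"
    have h: "?h 0 = []" "?h 1 = [(2, w1)]" "?h 2 = [(2, w1), (1, w2)]"
        "?h 3 = [(2, w1), (1, w2), (2, w3)]"
      by (simp_all add: w \<sigma>_def eval_nat_numeral)
    have p1: "has_path G v 2 w1" using step[of "[]"] v by (simp add: \<sigma>_def w)
    then have "w1 \<in> pverts G" by (blast dest: has_path_verts)
    then have p2: "has_path G w1 1 w2"
      using step[of "[(2, w1)]"] by (simp add: \<sigma>_def w token_def)
    then have "w2 \<in> pverts G" by (blast dest: has_path_verts)
    then have p3: "has_path G w2 2 w3"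
      using step[of "[(2, w1), (1, w2)]"] by (simp add: \<sigma>_def w token_def)
    \<comment> \<open>Colours separate \<open>v\<close>, \<open>w1\<close> from \<open>w2\<close>,
      \<open>w3\<close>; within each pair the ends of a path of length 2 are distinct.\<close>
    have col: "c w1 = c v" "c w2 \<noteq> c v" "c w3 = c w2"
      using c[OF p1] c[OF p2] c[OF p3] by auto
    have new: "v \<noteq> w1" "w2 \<noteq> w3" using has_path_neq[OF p1] has_path_neq[OF p3] by simp_all
    have "visited v (?h 3) = {v, w1, w2, w3}" using h by (simp add: visited_def)
    moreover have "v \<noteq> w2" "v \<noteq> w3" "w1 \<noteq> w2" "w1 \<noteq> w3" using col by metis+
    then have "card {v, w1, w2, w3} = 4" using new by simp
    ultimately have card3: "card (visited v (?h 3)) = 4" by simp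
    \<comment> \<open>If the game were over, the Director could answer the next length of
      \<open>\<sigma>\<close> by a visited vertex; this is refuted for the first three
      histories.\<close>
    have stay: "\<exists>w\<in>visited v h. has_path G (token v h) (\<sigma> h) w"
      if "game_over G v h" "token v h \<in> pverts G" for h
    proof -
      have "can_name G (token v h) (\<sigma> h)" using name[OF that(2)] by (simp add: \<sigma>_def)
      with that(1) show ?thesis
        unfolding game_over_def by (metis can_stay.cases)
    qed
    have over: "3 \<le> n" if "game_over G v (?h n)" for n
    proof (rule ccontr)
      assume "\<not> 3 \<le> n"
      then consider "n = 0" | "n = 1" | "n = 2" by linarith
      then show False
      proof cases
        case 1
        then show ?thesis using stay[of "[]"] that v has_path_neq[of G v 2 v] by (auto simp: \<sigma>_def)
      next
        case 2
        then have "game_over G v [(2, w1)]" using that h(2) by simp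
        \<comment> \<open>The colour of \<open>w\<close> is opposite to that of \<open>w1\<close>,
          whereas \<open>v\<close> and \<open>w1\<close> share theirs.\<close>
        then obtain w where "w \<in> {v, w1}" "has_path G w1 1 w"
          using stay[of "[(2, w1)]"] \<open>w1 \<in> pverts G\<close>
          by (auto simp: \<sigma>_def token_def visited_def)
        then show ?thesis using c[of w1 1 w] col by auto
      next
        case 3
        then have "game_over G v [(2, w1), (1, w2)]" using that h(3) by simp
        \<comment> \<open>Among the visited vertices only \<open>w2\<close> has the colour required
          of \<open>w\<close>, but a path of positive length cannot return to its start.\<close>
        then obtain w where "w \<in> {v, w1, w2}" "has_path G w2 2 w"
          using stay[of "[(2, w1), (1, w2)]"] \<open>w2 \<in> pverts G\<close>
          by (auto simp: \<sigma>_def token_def visited_def)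
        then show ?thesis using c[of w2 2 w] has_path_neq[of G w2 2 w] col by auto
      qed
    qed
    \<comment> \<open>Staying in the finite vertex set makes cardinality monotone, also for the
      union over an unending play.\<close>
    have sub: "visited v (?h n) \<subseteq> pverts G" for n
      using visited_subset[of v "pverts G" \<tau> \<sigma> n] v has_path_verts[OF step] by blast
    have ge: "4 \<le> card U" if "visited v (?h 3) \<subseteq> U" "U \<subseteq> pverts G" for U
      using that card3 G(1) by (metis card_mono finite_subset)
    show ?thesis
    proof (cases "\<exists>n. game_over G v (?h n)")
      case True
      then have "3 \<le> (LEAST n. game_over G v (?h n))" using over by (metis LeastI_ex)
      then show ?thesis
        using True ge[OF visited_play_mono sub] unfolding payoff_def by simp
    next
      case False
      have "4 \<le> card (\<Union>n. visited v (?h n))" by (rule ge) (use sub in \<open>blast+\<close>)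
      then show ?thesis using False unfolding payoff_def by simp
    qed
  qed
  with legal show ?thesis by blast
qed

theorem theorem3p3:
  fixes G :: "'a pair_pre_digraph" and v :: 'a
  assumes "pair_graph G"
    and "connected (with_proj G)"
    and "bipanpositionable G"
    and "4 \<le> card (pverts G)"
    and "v \<in> pverts G"
  shows "f_p G v = 4"
proof -
  interpret pair_graph G by fact
  have hb: "hamiltonian G" "bipartite G" using assms(3) unfolding bipanpositionable_def by auto
  have name: "can_name G u l" if "u \<in> pverts G" "0 < l" "l < 4" for u l
    using hamiltonian_path_from[OF hb(1) that(1), of l] assms(4) that unfolding can_name_def
    by auto
  \<comment> \<open>The four vertices of this path become the Director's trap.\<close>
  obtain w where "has_path G v 3 w"
    using hamiltonian_path_from[OF hb(1) assms(5), of 3] assms(4) by auto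
  then obtain f where f: "f 0 = v" "f 3 = w" "inj_on f {..3}" "f ` {..3} \<subseteq> pverts G"
      "\<forall>i<3. (f i, f (Suc i)) \<in> parcs G"
    unfolding has_path_iff by blast
  have sub: "has_path G (f i) l (f (i + l))" if "i + l \<le> 3" for i l
  proof -
    have "inj_on (\<lambda>j. f (i + j)) {..l}"
    proof (rule inj_onI)
      fix s t assume "s \<in> {..l}" "t \<in> {..l}" "f (i + s) = f (i + t)"
      then show "s = t" using inj_onD[OF f(3), of "i + s" "i + t"] that by simp
    qed
    then show ?thesis
      unfolding has_path_iff using f that by (intro exI[of _ "\<lambda>j. f (i + j)"]) auto
  qed
  have bwd: "has_path G (f (i + l)) l (f i)" if "i + l \<le> 3" for i l
    using sub[OF that] has_path_sym assms(1) by metis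
  \<comment> \<open>Positions run from 0 to 3: one step goes forward except at 3; two steps go
    forward from 0 and 1 and backward from 2 and 3.\<close>
  have near: "\<exists>w\<in>f ` {..3}. has_path G u 1 w" "\<exists>w\<in>f ` {..3}. has_path G u 2 w"
    if u: "u \<in> f ` {..3}" for u
  proof -
    from u obtain i where i: "i \<le> 3" "u = f i" by auto
    show "\<exists>w\<in>f ` {..3}. has_path G u 1 w"
      using sub[of i 1] bwd[of "i - 1" 1] i
      by (cases "i = 3") (auto intro: bexI[of _ "Suc i"] bexI[of _ "i - 1"])
    show "\<exists>w\<in>f ` {..3}. has_path G u 2 w"
    proof (cases "i < 2")
      case True
      then show ?thesis using sub[of i 2] i by (intro bexI[of _ "f (i + 2)"]) auto
    next
      case False
      then have "i - 2 + 2 = i" by simp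
      then show ?thesis using bwd[of "i - 2" 2] i by (intro bexI[of _ "f (i - 2)"]) auto
    qed
  qed
  \<comment> \<open>The parity of \<open>l\<close> selects the answer: the vertex one step away for
    odd \<open>l\<close>, the one two steps away for even \<open>l\<close>.\<close>
  have stay: "\<exists>w\<in>f ` {..3}. has_path G u l w" if u: "u \<in> f ` {..3}" "can_name G u l" for u l
  proof -
    have "0 < l" "l < card (pverts G)"
      using u(2) has_path_length[OF _ pair_finite_verts] unfolding can_name_def by auto
    then show ?thesis
      using near[OF u(1)] odd_path[OF assms(1,3)] even_path[OF assms(1,3)] by metis
  qed
  have "card (f ` {..3}) = 4" using f(3) by (simp add: card_image)
  moreover have "\<exists>l. can_name G u l" if "u \<in> f ` {..3}" for u
    using name[of u 1] f(4) that by auto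
  moreover have "\<exists>\<sigma>. legal_explorer G v \<sigma> \<and> (\<forall>\<tau>. legal_director G v \<tau> \<longrightarrow> 4 \<le> payoff G v \<sigma> \<tau>)"
    using explorer_lower_bound[OF pair_finite_verts hb(2) assms(5)] name by simp
  moreover have "v \<in> f ` {..3}" using f(1) by (auto intro: rev_image_eqI)
  ultimately have "game_value G v 4"
    using director_upper_bound[of "f ` {..3}" G v, OF _ f(4) _ stay]
    unfolding game_value_def by simp
  then show ?thesis
    unfolding f_p_def by (auto intro!: the_equality dest: game_value_unique)
qed

end
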